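(* Let $\Gamma_n$ be an $n$-sided planar convex polygon circumscribed about a circle of radius $R>0$, with perimeter $L_n$ and area $A_n$. Let $A_n^\ast$ be the area of the regular $n$-sided convex polygon circumscribed about the same circle, and let $d_n=n\tan\frac{\pi}{n}$. Then for all positive integers $\alpha,k$ with $k\ge 2$, $$L_n^{2\alpha}-4^\alpha\left(d_nA_n\right)^\alpha\le\frac{4^\alpha}{R^{2(k-1)\alpha}}\left[A_n^{k\alpha}-\left(A_n^\ast\right)^{k\alpha}\right]$$ and $$\left(\frac{A_n}{R^2}\right)^{2\alpha}-d_n^\alpha\left(\frac{L_n}{2R}\right)^\alpha\le\left(\frac{A_n}{R^2}\right)^{k\alpha}-\left(\frac{A_n^\ast}{R^2}\right)^{k\alpha}.$$ In each of the two inequalities, equality holds if and only if $\Gamma_n$ is a regular polygon.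
   Context: A convex polygon is circumscribed about a circle if every side of the polygon is tangent to the circle (the circle is the inscribed circle of the polygon). *)

theory Defs
  imports "HOL-Analysis.Analysis"
begin

(* A polygon is the closed two-dimensional region; its sides are its edges in the sense of
   face theory (one-dimensional faces), so no side has a straight angle at its end points
   and the number of sides is necessarily at least 3. *)

definition convex_polygon :: "nat \<Rightarrow> (real^2) set \<Rightarrow> bool" where
  "convex_polygon n P \<longleftrightarrow> polytope P \<and> aff_dim P = 2 \<and> card {e. e edge_of P} = n"

(* A side is a closed segment, and the diameter of a segment is its length. *)

definition perimeter :: "(real^2) set \<Rightarrow> real" where
  "perimeter P = (\<Sum>e | e edge_of P. diameter e)"

abbreviation area :: "(real^2) set \<Rightarrow> real" where
  "area P \<equiv> measure lebesgue P"

(* The side e is tangent to the circle: the line carrying e meets the circle in exactly one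
   point, and this point of contact lies on the side itself.  The second requirement excludes
   escribed circles, which touch the extensions of some sides only. *)

definition tangent_to_circle :: "(real^2) set \<Rightarrow> real^2 \<Rightarrow> real \<Rightarrow> bool" where
  "tangent_to_circle e c R \<longleftrightarrow> (\<exists>p\<in>e. affine hull e \<inter> sphere c R = {p})"

definition circumscribed_about :: "(real^2) set \<Rightarrow> real^2 \<Rightarrow> real \<Rightarrow> bool" where
  "circumscribed_about P c R \<longleftrightarrow> (\<forall>e. e edge_of P \<longrightarrow> tangent_to_circle e c R)"

definition angle_at :: "real^2 \<Rightarrow> real^2 \<Rightarrow> real^2 \<Rightarrow> real" where
  "angle_at v a b = arccos (((a - v) \<bullet> (b - v)) / (norm (a - v) * norm (b - v)))"

(* Equilateral and equiangular.  The interior angle at a vertex v is the angle between the two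
   different sides closed_segment v a and closed_segment v b that meet there. *)

definition regular_polygon :: "(real^2) set \<Rightarrow> bool" where
  "regular_polygon P \<longleftrightarrow>
     (\<exists>s. \<forall>e. e edge_of P \<longrightarrow> diameter e = s) \<and>
     (\<exists>\<theta>. \<forall>v a b. closed_segment v a edge_of P \<and> closed_segment v b edge_of P \<and> a \<noteq> b
             \<longrightarrow> angle_at v a b = \<theta>)"

end

theory Submission
  imports Defs
begin

text \<open>Let \<open>g\<^sub>0, \<dots>, g\<^sub>n\<^sub>-\<^sub>1\<close> be the angles between consecutive outer normals of the sides, so that they
  sum to \<open>2 \<pi>\<close>, and put \<open>x = \<Sum>\<^sub>i tan (g\<^sub>i / 2)\<close>. Every side is the sum of two adjacent tangent lengths
  \<open>R tan (g\<^sub>i / 2)\<close>, hence \<open>L = 2 R x\<close>, and cutting the polygon into triangles with apex at the centre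
  gives \<open>A = R L / 2 = R\<^sup>2 x\<close>. By strict convexity of the tangent, \<open>x \<ge> d\<close> with equality iff all \<open>g\<^sub>i\<close>
  are equal, that is, iff the polygon is regular (its interior angles are \<open>\<pi> - g\<^sub>i\<close>). With
  \<open>X = x\<^sup>\<alpha>\<close> and \<open>D = d\<^sup>\<alpha>\<close> both claims become \<open>X\<^sup>2 - D X \<le> X\<^sup>k - D\<^sup>k\<close>, which holds for \<open>X \<ge> D \<ge> 1\<close>.\<close>

section \<open>Unit vectors in the plane\<close>

definition dir :: "real \<Rightarrow> real^2" where
  "dir t = vector [cos t, sin t]"

lemma inner_real2: "x \<bullet> y = x $ 1 * y $ 1 + x $ 2 * (y $ 2)" for x y :: "real^2"
  by (simp add: inner_vec_def sum_2)

lemma dir_nth [simp]: "dir t $ 1 = cos t" "dir t $ 2 = sin t"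
  by (simp_all add: dir_def)

lemma inner_dir: "dir a \<bullet> dir b = cos (a - b)"
  by (simp add: inner_real2 cos_diff)

lemma norm_dir [simp]: "norm (dir t) = 1"
  by (simp add: norm_eq_1 inner_dir)

lemma dir_neq_0 [simp]: "dir t \<noteq> 0"
  using norm_dir[of t] by force

lemma dir_add_2pi [simp]: "dir (t + 2 * pi) = dir t"
  by (simp add: dir_def)

text \<open>The two vectors form an orthonormal frame: when \<open>dir t\<close> is the normal of a
  tangent line, \<open>dir (t + pi/2)\<close> is the direction of that line.\<close>

lemma dir_decomp:
  "x = (x \<bullet> dir t) *\<^sub>R dir t + (x \<bullet> dir (t + pi/2)) *\<^sub>R dir (t + pi/2)"
proof -
  have "sin t * sin t + cos t * cos t = 1"
    using sin_cos_squared_add[of t] by (simp add: power2_eq_square)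
  then have "x $ 1 = (x $ 1 * cos t + x $ 2 * sin t) * cos t - (x $ 2 * cos t - x $ 1 * sin t) * sin t"
    and "x $ 2 = (x $ 1 * cos t + x $ 2 * sin t) * sin t + (x $ 2 * cos t - x $ 1 * sin t) * cos t"
    by algebra+
  then show ?thesis
    by (simp add: vec_eq_iff forall_2 inner_real2 cos_add sin_add)
qed

lemma norm1_eq_dir:
  assumes "norm u = 1"
  obtains t where "0 \<le> t" "t < 2 * pi" "u = dir t"
proof -
  have "(u $ 1)\<^sup>2 + (u $ 2)\<^sup>2 = 1"
    using assms by (simp add: norm_eq_1 inner_real2 power2_eq_square)
  then obtain t where "0 \<le> t" "t < 2 * pi" "u $ 1 = cos t" "u $ 2 = sin t"
    by (rule sincos_total_2pi) (use that in blast)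
  then show thesis
    using that by (simp add: vec_eq_iff forall_2)
qed

text \<open>Equality case of Cauchy-Schwarz. It identifies two points of contact as soon as one lies
  on or beyond the tangent at the other.\<close>

lemma unit_vectors_eq:
  fixes u v :: "'a::real_inner"
  assumes "norm u = 1" "norm v = 1" "u \<bullet> v \<ge> 1"
  shows "u = v"
proof -
  have "(norm (u - v))\<^sup>2 = 2 - 2 * (u \<bullet> v)"
    using assms by (simp add: power2_norm_eq_inner inner_diff inner_commute norm_eq_1)
  then have "(norm (u - v))\<^sup>2 \<le> 0"
    using assms by simp
  then show ?thesis by simp
qed

section \<open>Sides of a circumscribed polygon as tangents with unit normals\<close>

text \<open>Reflecting \<open>p\<close> in the foot of the perpendicular from \<open>c\<close> gives
  a point \<open>p'\<close> that again lies on the hyperplane and on the sphere. Uniqueness forces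
  \<open>p' = p\<close>, so \<open>p\<close> is the foot itself.\<close>

lemma tangent_point_normal:
  fixes a c p :: "'a::real_inner"
  assumes "a \<noteq> 0" and tan: "{x. a \<bullet> x = b} \<inter> sphere c R = {p}"
  shows "p - c = ((b - a \<bullet> c) / (a \<bullet> a)) *\<^sub>R a"
proof -
  define m where "m = (b - a \<bullet> c) / (a \<bullet> a)"
  define p' where "p' = 2 *\<^sub>R (c + m *\<^sub>R a) - p"
  have p: "a \<bullet> p = b" "norm (p - c) = R"
    using tan by (auto simp: dist_norm norm_minus_commute)
  have aa: "m * (a \<bullet> a) = b - a \<bullet> c"
    using \<open>a \<noteq> 0\<close> by (simp add: m_def)
  have 1: "a \<bullet> p' = b"
    using p aa by (simp add: p'_def inner_diff inner_add algebra_simps)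
  have "(norm (p' - c))\<^sup>2 = (norm (p - c))\<^sup>2 + 4 * m * (m * (a \<bullet> a) - a \<bullet> (p - c))"
  proof -
    have "p' - c = (2 * m) *\<^sub>R a - (p - c)"
      by (simp add: p'_def scaleR_2 algebra_simps)
    then show ?thesis
      unfolding power2_norm_eq_inner
      by (simp only: inner_diff_left[of "_ *\<^sub>R _"] inner_diff_right[of _ "_ *\<^sub>R _"] inner_scaleR_left
          inner_scaleR_right inner_commute[of "p - c" a]) (simp add: algebra_simps)
  qed
  also have "a \<bullet> (p - c) = m * (a \<bullet> a)"
    using p aa by (simp add: inner_diff)
  finally have "norm (p' - c) = R"
    using p(2) norm_ge_zero[of "p - c"] by simp
  then have "p' \<in> {x. a \<bullet> x = b} \<inter> sphere c R"
    using 1 by (simp add: dist_norm norm_minus_commute)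
  then have "p' = p" using tan by auto
  then have "2 *\<^sub>R (c + m *\<^sub>R a) = 2 *\<^sub>R p"
    by (simp add: p'_def scaleR_2 algebra_simps)
  then have "c + m *\<^sub>R a = p"
    by (simp only: scaleR_cancel_left) simp
  then show ?thesis
    by (simp add: m_def[symmetric] algebra_simps)
qed

lemma unbounded_ray:
  fixes w x :: "'a::real_normed_vector"
  assumes "w \<noteq> 0" and "\<And>s. s \<ge> 0 \<Longrightarrow> x + s *\<^sub>R w \<in> S"
  shows "\<not> bounded S"
proof
  assume "bounded S"
  then obtain B where B: "\<And>y. y \<in> S \<Longrightarrow> norm y \<le> B" "B > 0"
    by (meson bounded_pos)
  define s where "s = (B + norm x + 1) / norm w"
  have s: "s \<ge> 0" "norm (s *\<^sub>R w) = B + norm x + 1"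
    using B(2) \<open>w \<noteq> 0\<close> by (auto simp: s_def)
  have "norm (s *\<^sub>R w) \<le> norm (x + s *\<^sub>R w) + norm x"
    using norm_triangle_ineq4[of "x + s *\<^sub>R w" x] by simp
  then show False
    using B(1)[OF assms(2)[OF s(1)]] s(2) by simp
qed

text \<open>Comparison of dimensions. This turns the tangency condition, stated for the affine hull
  of a side, into one on the line bounding a half-plane.\<close>

lemma affine_hull_eq_line:
  fixes a :: "real^2"
  assumes "a \<noteq> 0" "e \<subseteq> {x. a \<bullet> x = b}" "aff_dim e = 1"
  shows "affine hull e = {x. a \<bullet> x = b}"
proof (rule affine_dim_equal)
  show "affine hull e \<noteq> {}" using assms by auto
  show "affine hull e \<subseteq> {x. a \<bullet> x = b}"
    using assms(2) by (simp add: affine_hyperplane hull_minimal)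
  show "aff_dim (affine hull e) = aff_dim {x. a \<bullet> x = b}"
    using assms by (simp add: aff_dim_hyperplane)
qed (auto simp: affine_hyperplane)

text \<open>In a minimal representation of \<open>P\<close> by half-planes the bounding lines carry
  exactly the facets, which in dimension 2 are the edges. Tangency puts each point of contact at
  distance \<open>R\<close> from \<open>c\<close> along the normal, so each half-plane can be
  rewritten with a unit normal \<open>dir t\<close>; it then remains to show that it contains the
  circle.\<close>

lemma circumscribed_polygon_halfplanes:
  assumes "R > 0" "convex_polygon n P" "circumscribed_about P c R"
  obtains T where "finite T" "T \<subseteq> {0..<2 * pi}"
    "P = {x. \<forall>t\<in>T. (x - c) \<bullet> dir t \<le> R}"
    "{e. e edge_of P} = (\<lambda>t. P \<inter> {x. (x - c) \<bullet> dir t = R}) ` T"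
proof -
  have P: "polytope P" "aff_dim P = 2"
    using assms(2) by (auto simp: convex_polygon_def)
  have hullP: "affine hull P = UNIV"
    using P(2) aff_dim_eq_full[of P] by simp
  have "polyhedron P" by (simp add: P polytope_imp_polyhedron)
  then obtain F where "finite F" and PF: "P = affine hull P \<inter> \<Inter>F"
    and F: "\<forall>h\<in>F. \<exists>a b. a \<noteq> 0 \<and> h = {x. a \<bullet> x \<le> b}"
    and Fmin: "\<And>F'. F' \<subset> F \<Longrightarrow> P \<subset> affine hull P \<inter> \<Inter>F'"
    unfolding polyhedron_Int_affine_minimal by metis
  from F obtain a b where ab: "\<And>h. h \<in> F \<Longrightarrow> a h \<noteq> 0 \<and> h = {x. a h \<bullet> x \<le> b h}"
    by metis
  have PF': "P = \<Inter>F" using PF hullP by simp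
  have edge_iff: "e edge_of P \<longleftrightarrow> (\<exists>h. h \<in> F \<and> e = P \<inter> {x. a h \<bullet> x = b h})" for e
  proof -
    have "e edge_of P \<longleftrightarrow> e facet_of P"
      using P(2) by (auto simp: edge_of_def facet_of_def)
    also have "\<dots> \<longleftrightarrow> (\<exists>h. h \<in> F \<and> e = P \<inter> {x. a h \<bullet> x = b h})"
      by (rule facet_of_polyhedron_explicit[OF \<open>finite F\<close> PF ab Fmin])
    finally show ?thesis .
  qed
  have "\<exists>t\<ge>0. t < 2 * pi \<and> c + R *\<^sub>R dir t \<in> P \<and>
          {x. a h \<bullet> x = b h} = {x. (x - c) \<bullet> dir t = R} \<and>
          (h = {x. (x - c) \<bullet> dir t \<le> R} \<or> h = {x. (x - c) \<bullet> dir t \<ge> R})" if "h \<in> F" for h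
  proof -
    define e where "e = P \<inter> {x. a h \<bullet> x = b h}"
    have a: "a h \<noteq> 0" and h: "h = {x. a h \<bullet> x \<le> b h}" using ab that by auto
    have e: "e edge_of P" using that edge_iff e_def by blast
    have hull: "affine hull e = {x. a h \<bullet> x = b h}"
      by (rule affine_hull_eq_line) (use a e in \<open>auto simp: e_def edge_of_def\<close>)
    obtain p where p: "p \<in> e" "affine hull e \<inter> sphere c R = {p}"
      using e assms(3) by (auto simp: circumscribed_about_def tangent_to_circle_def)
    define m where "m = (b h - a h \<bullet> c) / (a h \<bullet> a h)"
    have pc: "p - c = m *\<^sub>R a h"
      using tangent_point_normal[OF a p(2)[unfolded hull]] by (simp add: m_def)
    have "p \<in> sphere c R" using p(2) by blast
    then have npc: "norm (p - c) = R" by (simp add: dist_norm norm_minus_commute)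
    have m0: "m \<noteq> 0" using npc pc \<open>R > 0\<close> by auto
    obtain t where t: "0 \<le> t" "t < 2 * pi" "(1/R) *\<^sub>R (p - c) = dir t"
      using norm1_eq_dir[of "(1/R) *\<^sub>R (p - c)"] npc \<open>R > 0\<close> by auto
    have pt: "p = c + R *\<^sub>R dir t" using \<open>R > 0\<close> by (simp flip: t(3))
    have ndir: "R * ((x - c) \<bullet> dir t) = m * ((x - c) \<bullet> a h)" for x
      using \<open>R > 0\<close> by (simp flip: t(3) add: pc)
    have bh: "m * (b h - a h \<bullet> c) = R\<^sup>2"
    proof -
      have "R\<^sup>2 = m * m * (a h \<bullet> a h)"
        using npc pc by (metis (no_types) inner_scaleR_left inner_scaleR_right mult.assoc power2_norm_eq_inner)
      then show ?thesis using a by (simp add: m_def)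
    qed
    \<comment> \<open>The two equations of the line agree up to the nonzero factors \<open>R\<close>
      and \<open>m\<close>; the sign of \<open>m\<close> decides on which side of the tangent
      \<open>h\<close> lies.\<close>
    have key: "R * ((x - c) \<bullet> dir t - R) = m * (a h \<bullet> x - b h)" for x
      using ndir[of x] bh by (simp add: algebra_simps power2_eq_square inner_diff inner_commute)
    have 1: "{x. a h \<bullet> x = b h} = {x. (x - c) \<bullet> dir t = R}"
      using key m0 \<open>R > 0\<close>  by (metis (no_types, lifting) mult_eq_0_iff order_less_irrefl right_minus_eq)
    have 2: "h = {x. (x - c) \<bullet> dir t \<le> R} \<or> h = {x. (x - c) \<bullet> dir t \<ge> R}"
    proof (cases "m > 0")
      case True
      have "a h \<bullet> x \<le> b h \<longleftrightarrow> (x - c) \<bullet> dir t \<le> R" for x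
      proof -
        have "a h \<bullet> x \<le> b h \<longleftrightarrow> m * (a h \<bullet> x - b h) \<le> 0"
          using True by (simp add: mult_le_0_iff)
        also have "\<dots> \<longleftrightarrow> (x - c) \<bullet> dir t \<le> R"
          using \<open>R > 0\<close> by (simp flip: key add: mult_le_0_iff)
        finally show ?thesis .
      qed
      then show ?thesis using h by blast
    next
      case False
      then have "m < 0" using m0 by simp
      have "a h \<bullet> x \<le> b h \<longleftrightarrow> (x - c) \<bullet> dir t \<ge> R" for x
      proof -
        have "a h \<bullet> x \<le> b h \<longleftrightarrow> m * (a h \<bullet> x - b h) \<ge> 0"
          using \<open>m < 0\<close> by (simp add: zero_le_mult_iff)
        also have "\<dots> \<longleftrightarrow> (x - c) \<bullet> dir t \<ge> R"
          using \<open>R > 0\<close> by (simp flip: key add: zero_le_mult_iff)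
        finally show ?thesis .
      qed
      then show ?thesis using h by blast
    qed
    have "c + R *\<^sub>R dir t \<in> P" using p(1) pt by (simp add: e_def)
    with t(1,2) 1 2 show ?thesis by blast
  qed
  then obtain \<tau> where \<tau>: "\<forall>h\<in>F. 0 \<le> \<tau> h \<and> \<tau> h < 2 * pi \<and> c + R *\<^sub>R dir (\<tau> h) \<in> P \<and>
          {x. a h \<bullet> x = b h} = {x. (x - c) \<bullet> dir (\<tau> h) = R} \<and>
          (h = {x. (x - c) \<bullet> dir (\<tau> h) \<le> R} \<or> h = {x. (x - c) \<bullet> dir (\<tau> h) \<ge> R})"
    using bchoice[of F] by metis
  have \<tau>_range: "\<tau> ` F \<subseteq> {0..<2 * pi}" using \<tau> by auto
  have contact: "c + R *\<^sub>R dir (\<tau> h) \<in> P" if "h \<in> F" for h using \<tau> that by blast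
  have line: "{x. a h \<bullet> x = b h} = {x. (x - c) \<bullet> dir (\<tau> h) = R}" if "h \<in> F" for h
    using \<tau> that by blast
  have sides: "h = {x. (x - c) \<bullet> dir (\<tau> h) \<le> R} \<or> h = {x. (x - c) \<bullet> dir (\<tau> h) \<ge> R}"
    if "h \<in> F" for h using \<tau> that by blast
  \<comment> \<open>If the circle lay on the wrong side of one tangent, all points of contact would coincide
    and the polygon would contain that whole tangent.\<close>
  have inner_side: "h = {x. (x - c) \<bullet> dir (\<tau> h) \<le> R}" if "h \<in> F" for h
  proof (rule ccontr)
    assume "h \<noteq> {x. (x - c) \<bullet> dir (\<tau> h) \<le> R}"
    then have h: "h = {x. (x - c) \<bullet> dir (\<tau> h) \<ge> R}" using sides[OF that] by blast
    have same: "dir (\<tau> g) = dir (\<tau> h)" if "g \<in> F" for g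
    proof (rule unit_vectors_eq)
      have "c + R *\<^sub>R dir (\<tau> g) \<in> h" using contact[OF that] \<open>h \<in> F\<close> PF' by blast
      then have "c + R *\<^sub>R dir (\<tau> g) \<in> {x. (x - c) \<bullet> dir (\<tau> h) \<ge> R}" using h by blast
      then show "dir (\<tau> g) \<bullet> dir (\<tau> h) \<ge> 1" using \<open>R > 0\<close> by simp
    qed auto
    have "(c + R *\<^sub>R dir (\<tau> h)) + s *\<^sub>R dir (\<tau> h + pi/2) \<in> P" (is "?x \<in> P") for s
    proof -
      have "?x \<in> g" if "g \<in> F" for g
      proof -
        have "(?x - c) \<bullet> dir (\<tau> g) = R"
          by (simp add: same[OF that] inner_add inner_dir)
        with sides[OF that] show ?thesis by (metis mem_Collect_eq order_refl)
      qed
      then show ?thesis unfolding PF' by blast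
    qed
    then have "\<not> bounded P" by (intro unbounded_ray[of "dir (\<tau> h + pi/2)"]) auto
    then show False using P(1) by (simp add: polytope_imp_bounded)
  qed
  show thesis
  proof (rule that)
    show "finite (\<tau> ` F)" using \<open>finite F\<close> by simp
    show "\<tau> ` F \<subseteq> {0..<2 * pi}" by (rule \<tau>_range)
    show "P = {x. \<forall>t\<in>\<tau> ` F. (x - c) \<bullet> dir t \<le> R}"
      using PF' inner_side by blast
    have "P \<inter> {x. a h \<bullet> x = b h} = P \<inter> {x. (x - c) \<bullet> dir (\<tau> h) = R}" if "h \<in> F" for h
      using line[OF that] by simp
    then show "{e. e edge_of P} = (\<lambda>t. P \<inter> {x. (x - c) \<bullet> dir t = R}) ` (\<tau> ` F)"
      unfolding edge_iff by blast
  qed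
qed

section \<open>Segments, periodic indices and pairs of tangents\<close>

lemma diameter_closed_segment: "diameter (closed_segment a b) = dist a b"
  for a b :: "'a::euclidean_space"
proof (rule antisym)
  have "dist x y \<le> dist a b" if "x \<in> closed_segment a b" "y \<in> closed_segment a b" for x y
    using segment_furthest_le[OF that(1), of y] segment_furthest_le[OF that(2)] segment_bound[OF that(2)]
    by (metis dist_norm norm_minus_commute order.trans)
  then show "diameter (closed_segment a b) \<le> dist a b"
    by (intro diameter_le) (auto simp: dist_norm)
  show "dist a b \<le> diameter (closed_segment a b)"
    by (rule diameter_bounded_bound) (auto simp: compact_imp_bounded)
qed

lemma affine_image_interval:
  fixes p v :: "'a::real_vector"
  assumes "a \<le> b"
  shows "(\<lambda>s::real. p + s *\<^sub>R v) ` {a..b} = closed_segment (p + a *\<^sub>R v) (p + b *\<^sub>R v)"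
proof -
  have "closed_segment (p + a *\<^sub>R v) (p + b *\<^sub>R v) = (+) p ` (\<lambda>s. s *\<^sub>R v) ` closed_segment a b"
    by (subst closed_segment_linear_image[symmetric])
      (auto simp: closed_segment_translation intro!: linearI scaleR_left_distrib)
  then show ?thesis
    using assms by (simp add: closed_segment_eq_real_ivl image_image)
qed

text \<open>Moving the window one step replaces \<open>k\<close> by \<open>k + n\<close>, where
  \<open>f\<close> has the same value. A tour around the polygon may therefore start at any
  index.\<close>

lemma image_period_eq_range:
  fixes f :: "nat \<Rightarrow> 'a"
  assumes "n > 0" and period: "\<And>i. f (i + n) = f i"
  shows "f ` {k..<k + n} = range f"
proof -
  have per: "f (i + n * m) = f i" for i m
    by (induction m) (use period in \<open>auto simp: algebra_simps\<close>, metis period add.assoc add.commute)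
  have fmod: "f i = f (i mod n)" for i
    by (metis per mod_mult_div_eq)
  have "f ` {k..<k + n} = f ` {..<n}"
  proof (induction k)
    case 0
    then show ?case by (simp add: lessThan_atLeast0)
  next
    case (Suc k)
    have "{Suc k..<Suc k + n} = insert (k + n) {Suc k..<k + n}" "{k..<k + n} = insert k {Suc k..<k + n}"
      using \<open>n > 0\<close> by auto
    then have "f ` {Suc k..<Suc k + n} = f ` {k..<k + n}"
      using period by simp
    with Suc show ?case by simp
  qed
  also have "\<dots> = range f"
    using fmod \<open>n > 0\<close> by (auto simp: image_iff) (metis lessThan_iff mod_less_divisor)
  finally show ?thesis .
qed

text \<open>Right triangle with legs \<open>1\<close> and \<open>tan h\<close> and hypotenuse
  \<open>1 / cos h\<close>. Applied with \<open>h\<close> and \<open>- h\<close>, it shows that two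
  tangents meet on the bisector of their normals.\<close>

lemma tangents_meet:
  assumes "cos h \<noteq> 0"
  shows "dir t + tan h *\<^sub>R dir (t + pi/2) = (1 / cos h) *\<^sub>R dir (t + h)"
proof -
  have "cos t - tan h * sin t = cos (t + h) / cos h" "sin t + tan h * cos t = sin (t + h) / cos h"
    using assms by (simp_all add: cos_add sin_add tan_def field_simps)
  then show ?thesis
    by (simp add: vec_eq_iff forall_2 cos_add sin_add)
qed

text \<open>Here \<open>w\<close> is the vertex as seen from the centre, and \<open>a\<close>,
  \<open>b\<close> lie on the rays from \<open>v\<close> through the two points of contact. Half the
  angle has sine \<open>R / norm w\<close>, so the cosine of the whole depends only on the distance
  of the vertex from the centre.\<close>

lemma tangent_angle:
  assumes w: "w \<bullet> dir x = R" "w \<bullet> dir y = R" and "R > 0" "dir x \<noteq> dir y"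
    and a: "a - v = k *\<^sub>R (R *\<^sub>R dir x - w)" "k > 0"
    and b: "b - v = l *\<^sub>R (R *\<^sub>R dir y - w)" "l > 0"
  shows "angle_at v a b = arccos (1 - 2 * R\<^sup>2 / (w \<bullet> w))"
proof -
  \<comment> \<open>\<open>s\<close> is the signed tangent length from the first point of contact to
    \<open>w\<close>.\<close>
  define \<alpha> \<beta> s where "\<alpha> = cos (y - x)" and "\<beta> = sin (y - x)" and "s = w \<bullet> dir (x + pi/2)"
  have w_eq: "w = R *\<^sub>R dir x + s *\<^sub>R dir (x + pi/2)"
    using dir_decomp[of w x] w by (simp add: s_def)
  have in1: "dir x \<bullet> dir y = \<alpha>" "dir y \<bullet> dir x = \<alpha>"
    by (auto simp: inner_dir \<alpha>_def cos_diff)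
  have in2: "dir (x + pi/2) \<bullet> dir y = \<beta>" "dir y \<bullet> dir (x + pi/2) = \<beta>"
    by (auto simp: inner_dir \<beta>_def cos_diff cos_add sin_add sin_diff algebra_simps)
  have in3: "dir x \<bullet> dir (x + pi/2) = 0" "dir (x + pi/2) \<bullet> dir x = 0" "dir z \<bullet> dir z = 1" for z
    by (auto simp: inner_dir)
  note ins = in1 in2 in3
  have ab1: "\<alpha>\<^sup>2 + \<beta>\<^sup>2 = 1" by (simp add: \<alpha>_def \<beta>_def)
  have \<alpha>1: "\<alpha> \<noteq> 1"
    using unit_vectors_eq[of "dir x" "dir y"] assms(4) in1 by auto
  have sb: "s * \<beta> = R * (1 - \<alpha>)"
    using w(2) by (simp add: w_eq inner_add ins algebra_simps)
  have s0: "s \<noteq> 0" using sb \<alpha>1 \<open>R > 0\<close> by auto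
  have ww: "w \<bullet> w = R\<^sup>2 + s\<^sup>2"
    by (simp add: w_eq inner_add ins power2_eq_square)
  have n1: "norm (R *\<^sub>R dir x - w) = \<bar>s\<bar>"
    by (simp add: w_eq)
  have "(norm (R *\<^sub>R dir y - w))\<^sup>2 = R * R - 2 * R * (w \<bullet> dir y) + w \<bullet> w"
    by (simp add: power2_norm_eq_inner inner_diff inner_commute ins)
  then have "(norm (R *\<^sub>R dir y - w))\<^sup>2 = s\<^sup>2"
    by (simp add: w ww power2_eq_square)
  then have n2: "norm (R *\<^sub>R dir y - w) = \<bar>s\<bar>"
    using power2_eq_iff_nonneg[of "norm (R *\<^sub>R dir y - w)" "\<bar>s\<bar>"] by simp
  have ip: "(R *\<^sub>R dir x - w) \<bullet> (R *\<^sub>R dir y - w) = s\<^sup>2 - R\<^sup>2 * (1 - \<alpha>)"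
  proof -
    have "(R *\<^sub>R dir x - w) \<bullet> (R *\<^sub>R dir y - w) = s\<^sup>2 - R * (s * \<beta>)"
      by (simp add: w_eq inner_diff inner_add ins power2_eq_square algebra_simps)
    then show ?thesis by (simp add: sb power2_eq_square)
  qed
  \<comment> \<open>Squaring \<open>sb\<close> eliminates \<open>\<beta>\<close>; the factor
    \<open>1 - \<alpha>\<close> then cancels because the normals differ.\<close>
  have "(1 - \<alpha>) * (s\<^sup>2 * (1 + \<alpha>)) = (s * \<beta>)\<^sup>2"
    using ab1 by algebra
  also have "\<dots> = (1 - \<alpha>) * (R\<^sup>2 * (1 - \<alpha>))"
    unfolding sb by (simp add: power2_eq_square)
  finally have "s\<^sup>2 * (1 + \<alpha>) = R\<^sup>2 * (1 - \<alpha>)" using \<alpha>1 by simp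
  then have e: "(1 - \<alpha>) * (R\<^sup>2 + s\<^sup>2) = 2 * s\<^sup>2" by algebra
  have pos: "R\<^sup>2 + s\<^sup>2 > 0" using \<open>R > 0\<close> by (simp add: add_pos_nonneg)
  have "((a - v) \<bullet> (b - v)) / (norm (a - v) * norm (b - v)) = (s\<^sup>2 - R\<^sup>2 * (1 - \<alpha>)) / s\<^sup>2"
    using a(2) b(2) by (simp add: a(1) b(1) ip n1 n2 power2_eq_square)
  also have "\<dots> = 1 - 2 * R\<^sup>2 / (w \<bullet> w)"
  proof -
    have "(s\<^sup>2 - R\<^sup>2 * (1 - \<alpha>)) * (R\<^sup>2 + s\<^sup>2) = s\<^sup>2 * (R\<^sup>2 + s\<^sup>2 - 2 * R\<^sup>2)"
      using e by algebra
    then show ?thesis using s0 pos unfolding ww by (simp add: divide_simps)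
  qed
  finally show ?thesis by (simp add: angle_at_def)
qed

section \<open>Convexity of the tangent function and the power inequality\<close>

text \<open>Strict convexity: the derivative \<open>1 + tan^2\<close> increases strictly on the
  interval, so by the mean value theorem the secant slope exceeds the slope at \<open>m\<close> to
  the right of \<open>m\<close> and falls below it to the left.\<close>

lemma tan_above_tangent:
  fixes x m :: real
  assumes "0 < x" "x < pi/2" "0 < m" "m < pi/2" "x \<noteq> m"
  shows "tan m + (1 + (tan m)\<^sup>2) * (x - m) < tan x"
proof -
  have der: "(tan has_real_derivative 1 + (tan z)\<^sup>2) (at z)" if "0 < z" "z < pi/2" for z
  proof -
    have "cos z \<noteq> 0" using that cos_gt_zero[of z] by simp
    then show ?thesis using DERIV_tan[of z] by (simp add: tan_sec power_inverse)
  qed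
  show ?thesis
  proof (cases "m < x")
    case True
    then obtain z where z: "m < z" "z < x" "tan x - tan m = (x - m) * (1 + (tan z)\<^sup>2)"
      using MVT2[of m x tan "\<lambda>z. 1 + (tan z)\<^sup>2"] der assms by (metis order_le_less_trans order_less_le_trans)
    have "tan m < tan z" "0 < tan m" using z assms by (auto intro!: tan_monotone tan_gt_zero)
    then have "(tan m)\<^sup>2 < (tan z)\<^sup>2" by (intro power_strict_mono) auto
    then have "(x - m) * (1 + (tan m)\<^sup>2) < (x - m) * (1 + (tan z)\<^sup>2)" using True by simp
    then show ?thesis using z(3) by (simp add: mult.commute)
  next
    case False
    then have "x < m" using assms by simp
    then obtain z where z: "x < z" "z < m" "tan m - tan x = (m - x) * (1 + (tan z)\<^sup>2)"
      using MVT2[of x m tan "\<lambda>z. 1 + (tan z)\<^sup>2"] der assms by (metis order_le_less_trans order_less_le_trans)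
    have "tan z < tan m" "0 < tan z" using z assms by (auto intro!: tan_monotone tan_gt_zero)
    then have "(tan z)\<^sup>2 < (tan m)\<^sup>2" by (intro power_strict_mono) auto
    then have "(m - x) * (1 + (tan z)\<^sup>2) < (m - x) * (1 + (tan m)\<^sup>2)" using \<open>x < m\<close> by simp
    then show ?thesis using z(3) by (simp add: algebra_simps)
  qed
qed

text \<open>Jensen's inequality with its equality case. The tangent line bounds at the mean
  \<open>m\<close> are added and their linear terms cancel; a single \<open>h i\<close> different
  from \<open>m\<close> makes the sum strict.\<close>

lemma sum_tan_ge:
  fixes h :: "'i \<Rightarrow> real"
  assumes "finite I" and h: "\<And>i. i \<in> I \<Longrightarrow> 0 < h i \<and> h i < pi/2" and m: "0 < m" "m < pi/2"
    and sum: "(\<Sum>i\<in>I. h i) = real (card I) * m"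
  shows "real (card I) * tan m \<le> (\<Sum>i\<in>I. tan (h i))"
    and "(\<Sum>i\<in>I. tan (h i)) = real (card I) * tan m \<longleftrightarrow> (\<forall>i\<in>I. h i = m)"
proof -
  define f where "f i = tan m + (1 + (tan m)\<^sup>2) * (h i - m)" for i
  have le: "f i \<le> tan (h i)" if "i \<in> I" for i
    using tan_above_tangent[of "h i" m] h[OF that] m by (cases "h i = m") (auto simp: f_def)
  have sumf: "sum f I = real (card I) * tan m"
    unfolding f_def by (simp add: sum.distrib sum_subtractf sum flip: sum_distrib_left)
  show ge: "real (card I) * tan m \<le> (\<Sum>i\<in>I. tan (h i))"
    using sum_mono[of I f, OF le] sumf by simp
  show "(\<Sum>i\<in>I. tan (h i)) = real (card I) * tan m \<longleftrightarrow> (\<forall>i\<in>I. h i = m)"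
  proof
    assume eq: "(\<Sum>i\<in>I. tan (h i)) = real (card I) * tan m"
    show "\<forall>i\<in>I. h i = m"
    proof (rule ccontr)
      assume "\<not> (\<forall>i\<in>I. h i = m)"
      then obtain i where i: "i \<in> I" "h i \<noteq> m" by blast
      then have "f i < tan (h i)"
        using tan_above_tangent[of "h i" m] h[OF i(1)] m by (simp add: f_def)
      then have "sum f I < (\<Sum>i\<in>I. tan (h i))"
        using i \<open>finite I\<close> le by (intro sum_strict_mono_ex1) auto
      then show False using eq sumf by simp
    qed
  qed auto
qed

lemma pow_diff_le:
  fixes X D :: real
  assumes "1 \<le> D" "D \<le> X" "2 \<le> k"
  shows "X\<^sup>2 - D * X \<le> X ^ k - D ^ k"
    and "X\<^sup>2 - D * X = X ^ k - D ^ k \<longleftrightarrow> X = D"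
proof -
  obtain m where k: "k = Suc (Suc m)"
    using \<open>2 \<le> k\<close> by (metis Suc_le_D numeral_2_eq_2 Suc_le_mono)
  \<comment> \<open>Both summands are nonnegative. Equality is read off the second one, because the
    first vanishes identically for \<open>k = 2\<close>.\<close>
  have eq: "X ^ k - D ^ k - (X\<^sup>2 - D * X) =
      (X - D) * (X ^ Suc m - X) + D * (X ^ Suc m - D ^ Suc m)"
    by (simp add: k algebra_simps power2_eq_square)
  have "X * 1 \<le> X * X ^ m"
    using assms by (intro mult_left_mono one_le_power) auto
  then have 1: "0 \<le> (X - D) * (X ^ Suc m - X)"
    using assms by (intro mult_nonneg_nonneg) auto
  have "D ^ Suc m \<le> X ^ Suc m"
    using assms by (intro power_mono) auto
  then have 2: "0 \<le> D * (X ^ Suc m - D ^ Suc m)"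
    using assms by (intro mult_nonneg_nonneg) auto
  show "X\<^sup>2 - D * X \<le> X ^ k - D ^ k"
    using eq 1 2 by linarith
  show "X\<^sup>2 - D * X = X ^ k - D ^ k \<longleftrightarrow> X = D"
  proof
    assume "X\<^sup>2 - D * X = X ^ k - D ^ k"
    with eq 1 2 have "D * (X ^ Suc m - D ^ Suc m) = 0" by linarith
    then have "X ^ Suc m = D ^ Suc m" using assms by simp
    then show "X = D" using assms power_eq_imp_eq_base[of X "Suc m" D] by simp
  qed (simp add: power2_eq_square)
qed

section \<open>Circumscribed polygons with cyclically ordered normals\<close>

text \<open>The angles of the normals form an infinite increasing sequence that gains
  \<open>2 * pi\<close> every \<open>n\<close> steps, so neighbours and gaps need no arithmetic
  modulo \<open>n\<close>. That \<open>n\<close> is the number of edges is derived in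
  \<open>card_edges\<close>.\<close>

locale tangential_polygon =
  fixes \<theta> :: "nat \<Rightarrow> real" and n :: nat and c :: "real^2" and R :: real and P :: "(real^2) set"
  assumes R_pos: "R > 0" and n_pos: "n > 0"
    and \<theta>_less_Suc: "\<theta> i < \<theta> (Suc i)"
    and \<theta>_period: "\<theta> (i + n) = \<theta> i + 2 * pi"
    and P_eq: "P = {x. \<forall>i. (x - c) \<bullet> dir (\<theta> i) \<le> R}"
    and edges_eq: "{e. e edge_of P} = range (\<lambda>i. P \<inter> {x. (x - c) \<bullet> dir (\<theta> i) = R})"
    and bounded_P: "bounded P"
begin

text \<open>The index is shifted so that \<open>side i\<close> joins \<open>vertex i\<close>, where the tangents at \<open>\<theta> i\<close> and
  \<open>\<theta> (Suc i)\<close> meet, to \<open>vertex (Suc i)\<close>.\<close>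

definition side :: "nat \<Rightarrow> (real^2) set" where
  "side i = P \<inter> {x. (x - c) \<bullet> dir (\<theta> (Suc i)) = R}"

definition gap :: "nat \<Rightarrow> real" where
  "gap i = \<theta> (Suc i) - \<theta> i"

text \<open>The right triangle of centre, contact point and vertex has leg \<open>R\<close> and
  angle \<open>gap i / 2\<close> at the centre; its hypotenuse lies on the bisector of the
  normals.\<close>

definition vertex :: "nat \<Rightarrow> real^2" where
  "vertex i = c + (R / cos (gap i / 2)) *\<^sub>R dir (\<theta> i + gap i / 2)"

lemma \<theta>_strict_mono: "i < j \<Longrightarrow> \<theta> i < \<theta> j"
  by (rule lift_Suc_mono_less[of \<theta>, OF \<theta>_less_Suc])

lemma \<theta>_mono: "i \<le> j \<Longrightarrow> \<theta> i \<le> \<theta> j"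
  using \<theta>_strict_mono[of i j] by (cases "i < j") auto

lemma dir_period: "dir (\<theta> (i + n)) = dir (\<theta> i)"
  by (simp add: \<theta>_period)

lemma gap_period: "gap (i + n) = gap i"
  using \<theta>_period[of i] \<theta>_period[of "Suc i"] by (simp add: gap_def)

lemma dir_window: "\<exists>k\<in>{i..<i + n}. dir (\<theta> j) = dir (\<theta> k)"
proof -
  have "(\<lambda>j. dir (\<theta> j)) ` {i..<i + n} = range (\<lambda>j. dir (\<theta> j))"
    by (rule image_period_eq_range) (simp_all add: n_pos dir_period)
  then have "dir (\<theta> j) \<in> (\<lambda>j. dir (\<theta> j)) ` {i..<i + n}" by simp
  then show ?thesis by blast
qed

text \<open>One full turn of constraints suffices, and it may begin at whichever index suits the
  estimate at hand.\<close>

lemma P_window: "x \<in> P \<longleftrightarrow> (\<forall>k\<in>{i..<i + n}. (x - c) \<bullet> dir (\<theta> k) \<le> R)"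
proof
  assume r: "\<forall>k\<in>{i..<i + n}. (x - c) \<bullet> dir (\<theta> k) \<le> R"
  have "(x - c) \<bullet> dir (\<theta> j) \<le> R" for j
    using dir_window[of i j] r by force
  then show "x \<in> P" by (simp add: P_eq)
qed (simp add: P_eq)

lemma sum_gap: "(\<Sum>i<n. gap i) = 2 * pi"
  using \<theta>_period[of 0] by (simp add: gap_def sum_lessThan_telescope)

lemma sum_Suc_gap: "(\<Sum>i<n. f (gap (Suc i))) = (\<Sum>i<n. f (gap i))" for f :: "real \<Rightarrow> real"
  using sum.lessThan_Suc_shift[of "\<lambda>i. f (gap i)" n] gap_period[of 0] by simp

text \<open>Since \<open>R > 0\<close>, the centre satisfies all constraints, and moving along
  \<open>w\<close> increases none of the left-hand sides. The ray from \<open>c\<close> would stay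
  in the bounded set \<open>P\<close>.\<close>

lemma no_ray:
  assumes "w \<noteq> 0" "\<And>k. k \<in> {i..<i + n} \<Longrightarrow> w \<bullet> dir (\<theta> k) \<le> 0"
  shows False
proof -
  have "c + s *\<^sub>R w \<in> P" if "s \<ge> 0" for s
  proof -
    have "s * (w \<bullet> dir (\<theta> k)) \<le> R" if "k \<in> {i..<i + n}" for k
      using mult_nonneg_nonpos[OF \<open>s \<ge> 0\<close> assms(2)[OF that]] R_pos by simp
    then show ?thesis by (simp add: P_window[of _ i])
  qed
  then show False using unbounded_ray[OF assms(1)] bounded_P by blast
qed

lemma gap_pos: "0 < gap i"
  using \<theta>_less_Suc by (simp add: gap_def)

lemma gap_less_pi: "gap i < pi"
proof (rule ccontr)
  assume "\<not> gap i < pi"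
  then have ge: "\<theta> (Suc i) - \<theta> i \<ge> pi" by (simp add: gap_def)
  \<comment> \<open>\<open>mid\<close> bisects the arc from \<open>\<theta> (Suc i)\<close> to
    \<open>\<theta> i + 2 * pi\<close>. A gap of at least \<open>pi\<close> leaves this arc a length
    of at most \<open>pi\<close>, so every normal is within \<open>pi/2\<close> of
    \<open>mid\<close> and \<open>P\<close> would contain a ray in direction
    \<open>- dir mid\<close>.\<close>
  define mid where "mid = (\<theta> (Suc i) + \<theta> i + 2 * pi) / 2"
  then have mid: "2 * mid = \<theta> (Suc i) + \<theta> i + 2 * pi" by simp
  show False
  proof (rule no_ray[of "- dir mid"])
    fix k assume k: "k \<in> {Suc i..<Suc i + n}"
    then have "\<theta> (Suc i) \<le> \<theta> k" "\<theta> k \<le> \<theta> i + 2 * pi"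
      using \<theta>_mono[of "Suc i" k] \<theta>_mono[of k "i + n"] by (auto simp: \<theta>_period)
    then have "- (pi/2) \<le> mid - \<theta> k" "mid - \<theta> k \<le> pi/2"
      using ge mid by linarith+
    then have "0 \<le> cos (mid - \<theta> k)" by (rule cos_ge_zero)
    then show "- dir mid \<bullet> dir (\<theta> k) \<le> 0" by (simp add: inner_dir)
  qed simp
qed

lemma half_gap: "0 < gap i / 2" "gap i / 2 < pi/2"
  using gap_pos gap_less_pi by auto

lemma cos_half_gap: "0 < cos (gap i / 2)" "cos (gap i / 2) < 1"
proof -
  show "0 < cos (gap i / 2)"
    using half_gap[of i] by (intro cos_gt_zero) auto
  have "cos (gap i / 2) < cos 0"
    using half_gap[of i] by (intro cos_monotone_0_pi) auto
  then show "cos (gap i / 2) < 1" by simp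
qed

lemma n_ge_3: "n \<ge> 3"
proof (rule ccontr)
  assume "\<not> n \<ge> 3"
  then have "real n \<le> 2" by simp
  have "(\<Sum>i<n. gap i) < (\<Sum>i<n. pi)"
    using n_pos gap_less_pi by (intro sum_strict_mono) auto
  also have "\<dots> \<le> 2 * pi" using \<open>real n \<le> 2\<close> by (simp add: mult_right_mono)
  finally show False using sum_gap by simp
qed

lemma dir_\<theta>_inj:
  assumes "i < j" "j < i + n"
  shows "dir (\<theta> i) \<noteq> dir (\<theta> j)"
proof
  assume "dir (\<theta> i) = dir (\<theta> j)"
  then have "cos (\<theta> j - \<theta> i) = 1"
    using inner_dir[of "\<theta> j" "\<theta> i"] inner_dir[of "\<theta> j" "\<theta> j"] by simp
  moreover have "0 < \<theta> j - \<theta> i" "\<theta> j - \<theta> i < 2 * pi"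
    using \<theta>_strict_mono[OF assms(1)] \<theta>_strict_mono[OF assms(2)] by (auto simp: \<theta>_period)
  moreover from this obtain m :: int where m: "\<theta> j - \<theta> i = real_of_int m * (2 * pi)"
    using \<open>cos (\<theta> j - \<theta> i) = 1\<close> cos_one_2pi_int[of "\<theta> j - \<theta> i"] by (auto simp: mult.assoc)
  ultimately have "0 < real_of_int m * (2 * pi)" "real_of_int m * (2 * pi) < 1 * (2 * pi)"
    by simp_all
  then have "0 < m" "m < 1"
    by (simp_all only: zero_less_mult_iff mult_less_cancel_right) auto
  then show False by simp
qed

text \<open>A vertex in the coordinate along either of its two tangents, measured from the contact
  point in units of \<open>R\<close>: positive on the earlier tangent, negative on the later
  one.\<close>

lemma vertex_eq:
  "vertex i = c + R *\<^sub>R dir (\<theta> i) + tan (gap i / 2) *\<^sub>R (R *\<^sub>R dir (\<theta> i + pi/2))"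
  "vertex i = c + R *\<^sub>R dir (\<theta> (Suc i)) + (- tan (gap i / 2)) *\<^sub>R (R *\<^sub>R dir (\<theta> (Suc i) + pi/2))"
proof -
  define h where "h = gap i / 2"
  have c0: "cos h \<noteq> 0" using cos_half_gap[of i] by (simp add: h_def)
  have s: "\<theta> (Suc i) - h = \<theta> i + h" by (simp add: h_def gap_def field_simps)
  have "R *\<^sub>R (dir (\<theta> i) + tan h *\<^sub>R dir (\<theta> i + pi/2)) = (R / cos h) *\<^sub>R dir (\<theta> i + h)"
    by (simp add: tangents_meet[OF c0])
  then show "vertex i = c + R *\<^sub>R dir (\<theta> i) + tan (gap i / 2) *\<^sub>R (R *\<^sub>R dir (\<theta> i + pi/2))"
    by (simp add: vertex_def h_def scaleR_add_right mult.commute)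
  have "R *\<^sub>R (dir (\<theta> (Suc i)) + tan (- h) *\<^sub>R dir (\<theta> (Suc i) + pi/2)) = (R / cos h) *\<^sub>R dir (\<theta> i + h)"
    using tangents_meet[of "- h" "\<theta> (Suc i)"] c0 s by simp
  then show "vertex i = c + R *\<^sub>R dir (\<theta> (Suc i)) + (- tan (gap i / 2)) *\<^sub>R (R *\<^sub>R dir (\<theta> (Suc i) + pi/2))"
    by (simp add: vertex_def h_def scaleR_diff_right mult.commute)
qed

text \<open>Let \<open>\<eta>\<close> be half the angle from the normal of this tangent to the
  normal \<open>k\<close>. Where \<open>sin \<eta> > 0\<close>, constraint \<open>k\<close> reads
  \<open>s * cos \<eta> \<le> sin \<eta>\<close>. The two neighbouring tangents give the stated
  bounds, and these imply all other constraints.\<close>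

lemma tangent_point_in_P_iff:
  defines "\<phi> \<equiv> \<lambda>i. \<theta> (Suc i)"
  shows "c + R *\<^sub>R dir (\<phi> i) + s *\<^sub>R (R *\<^sub>R dir (\<phi> i + pi/2)) \<in> P \<longleftrightarrow>
    - tan (gap i / 2) \<le> s \<and> s \<le> tan (gap (Suc i) / 2)" (is "?x \<in> P \<longleftrightarrow> ?r")
proof -
  \<comment> \<open>The factor \<open>sin \<eta>\<close> stays on both sides because it is negative
    for the preceding normal.\<close>
  have half: "cos (2 * \<eta>) + s * sin (2 * \<eta>) \<le> 1 \<longleftrightarrow> sin \<eta> * (s * cos \<eta>) \<le> sin \<eta> * sin \<eta>" for \<eta>
  proof -
    have "cos (2 * \<eta>) = 1 - 2 * (sin \<eta> * sin \<eta>)" "sin (2 * \<eta>) = 2 * sin \<eta> * cos \<eta>"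
      by (simp_all add: cos_double_sin sin_double power2_eq_square)
    then have "cos (2 * \<eta>) + s * sin (2 * \<eta>) - 1 = 2 * (sin \<eta> * (s * cos \<eta>) - sin \<eta> * sin \<eta>)"
      by (simp only:) (simp add: algebra_simps)
    then have "cos (2 * \<eta>) + s * sin (2 * \<eta>) \<le> 1 \<longleftrightarrow>
        2 * (sin \<eta> * (s * cos \<eta>) - sin \<eta> * sin \<eta>) \<le> 0"
      using diff_le_0_iff_le[of "cos (2 * \<eta>) + s * sin (2 * \<eta>)" 1] by (simp only:)
    also have "\<dots> \<longleftrightarrow> sin \<eta> * (s * cos \<eta>) \<le> sin \<eta> * sin \<eta>"
      by (subst mult_le_0_iff) simp
    finally show ?thesis .
  qed
  have ineq: "(?x - c) \<bullet> dir (\<theta> k) \<le> R \<longleftrightarrow>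
      sin ((\<theta> k - \<phi> i) / 2) * (s * cos ((\<theta> k - \<phi> i) / 2)) \<le>
      sin ((\<theta> k - \<phi> i) / 2) * sin ((\<theta> k - \<phi> i) / 2)" for k
  proof -
    have "cos (\<phi> i - \<theta> k) = cos (\<theta> k - \<phi> i)"
      using cos_minus[of "\<theta> k - \<phi> i"] by simp
    moreover have "cos (\<phi> i + pi/2 - \<theta> k) = sin (\<theta> k - \<phi> i)"
      by (simp add: sin_diff cos_diff cos_add sin_add)
    ultimately have "(?x - c) \<bullet> dir (\<theta> k) = R * (cos (\<theta> k - \<phi> i) + s * sin (\<theta> k - \<phi> i))"
      by (simp add: inner_add inner_dir algebra_simps)
    then have "(?x - c) \<bullet> dir (\<theta> k) \<le> R \<longleftrightarrow> cos (\<theta> k - \<phi> i) + s * sin (\<theta> k - \<phi> i) \<le> 1"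
      using R_pos by simp
    moreover have "2 * ((\<theta> k - \<phi> i) / 2) = \<theta> k - \<phi> i" by simp
    ultimately show ?thesis using half[of "(\<theta> k - \<phi> i) / 2"] by (simp only:)
  qed
  have next_gap: "(\<theta> (Suc (Suc i)) - \<phi> i) / 2 = gap (Suc i) / 2"
    and prev_gap: "(\<theta> i - \<phi> i) / 2 = - (gap i / 2)"
    by (simp_all add: \<phi>_def gap_def field_simps)
  have sin_pos: "0 < sin (gap k / 2)" for k
    using half_gap[of k] by (intro sin_gt_zero) auto
  show ?thesis
  proof
    assume "?x \<in> P"
    then have all: "(?x - c) \<bullet> dir (\<theta> k) \<le> R" for k unfolding P_eq by blast
    have "s * cos (gap (Suc i) / 2) \<le> sin (gap (Suc i) / 2)"
      using all[of "Suc (Suc i)"] sin_pos[of "Suc i"] unfolding ineq next_gap by simp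
    moreover have "sin (gap i / 2) * - (s * cos (gap i / 2)) \<le> sin (gap i / 2) * sin (gap i / 2)"
      using all[of i] unfolding ineq prev_gap by simp
    then have "- (s * cos (gap i / 2)) \<le> sin (gap i / 2)"
      by (rule mult_left_le_imp_le[OF _ sin_pos])
    ultimately show ?r
      using cos_half_gap[of i] cos_half_gap[of "Suc i"] by (simp add: tan_def field_simps)
  next
    assume ?r
    then have s1: "s * cos (gap (Suc i) / 2) \<le> sin (gap (Suc i) / 2)"
      and s2: "- s * cos (gap i / 2) \<le> sin (gap i / 2)"
      using cos_half_gap[of i] cos_half_gap[of "Suc i"] by (simp_all add: tan_def field_simps)
    \<comment> \<open>The window runs from the tangent itself to index \<open>i + n\<close>, the
      preceding tangent one turn later; beyond its first index \<open>sin \<eta>\<close> is positive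
      throughout.\<close>
    have "(?x - c) \<bullet> dir (\<theta> k) \<le> R" if k: "k \<in> {Suc i..<Suc i + n}" for k
    proof (cases "k = Suc i")
      case True
      then show ?thesis unfolding ineq by (simp add: \<phi>_def)
    next
      case False
      define \<eta> where "\<eta> = (\<theta> k - \<phi> i) / 2"
      have "\<theta> (Suc (Suc i)) \<le> \<theta> k" "\<theta> k \<le> \<theta> i + 2 * pi"
        using \<theta>_mono[of "Suc (Suc i)" k] \<theta>_mono[of k "i + n"] k False by (auto simp: \<theta>_period)
      then have \<eta>: "gap (Suc i) / 2 \<le> \<eta>" "\<eta> \<le> pi - gap i / 2"
        by (simp_all add: \<eta>_def \<phi>_def gap_def field_simps)
      have sin0: "0 < sin \<eta>"
        using \<eta> half_gap[of i] half_gap[of "Suc i"] by (intro sin_gt_zero) auto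
      have "s * cos \<eta> \<le> sin \<eta>"
      \<comment> \<open>For \<open>cos \<eta> \<ge> 0\<close> the bound from the next tangent is
        decisive, otherwise the bound from the preceding one.\<close>
      proof (cases "cos \<eta> \<ge> 0")
        case True
        define g where "g = gap (Suc i) / 2"
        have "0 \<le> sin (\<eta> - g)"
          using \<eta> half_gap[of i] half_gap[of "Suc i"] by (intro sin_ge_zero) (auto simp: g_def)
        then have "sin g * cos \<eta> \<le> sin \<eta> * cos g"
          by (simp add: sin_diff mult.commute)
        moreover have "s * cos g * cos \<eta> \<le> sin g * cos \<eta>"
          using s1 True by (intro mult_right_mono) (auto simp: g_def)
        ultimately have "cos g * (s * cos \<eta>) \<le> cos g * sin \<eta>"
          by (simp add: mult_ac)
        then show ?thesis using cos_half_gap[of "Suc i"] by (simp add: g_def)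
      next
        case False
        define g where "g = gap i / 2"
        have "0 \<le> sin (\<eta> + g)"
          using \<eta> half_gap[of i] half_gap[of "Suc i"] by (intro sin_ge_zero) (auto simp: g_def)
        then have "sin g * (- cos \<eta>) \<le> sin \<eta> * cos g"
          by (simp add: sin_add mult.commute)
        moreover have "- s * cos g * (- cos \<eta>) \<le> sin g * (- cos \<eta>)"
          using s2 False by (intro mult_right_mono) (auto simp: g_def)
        ultimately have "cos g * (s * cos \<eta>) \<le> cos g * sin \<eta>"
          by (simp add: mult_ac)
        then show ?thesis using cos_half_gap[of i] by (simp add: g_def)
      qed
      then show ?thesis
        unfolding ineq using sin0 by (simp add: \<eta>_def)
    qed
    then show "?x \<in> P" by (simp add: P_window[of _ "Suc i"])
  qed
qed

lemma side_eq_image: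
  "side i = (\<lambda>s. c + R *\<^sub>R dir (\<theta> (Suc i)) + s *\<^sub>R (R *\<^sub>R dir (\<theta> (Suc i) + pi/2))) `
     {- tan (gap i / 2)..tan (gap (Suc i) / 2)}" (is "_ = ?f ` _")
proof -
  have param: "\<exists>s. x = ?f s" if "(x - c) \<bullet> dir (\<theta> (Suc i)) = R" for x
  proof -
    define m where "m = (x - c) \<bullet> dir (\<theta> (Suc i) + pi/2)"
    have "x - c = R *\<^sub>R dir (\<theta> (Suc i)) + m *\<^sub>R dir (\<theta> (Suc i) + pi/2)"
      using dir_decomp[of "x - c" "\<theta> (Suc i)"] unfolding that m_def .
    then have "x = ?f (m / R)" using R_pos by (simp add: algebra_simps)
    then show ?thesis ..
  qed
  have line: "(?f s - c) \<bullet> dir (\<theta> (Suc i)) = R" for s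
    by (simp add: inner_add inner_dir)
  have inP: "?f s \<in> P \<longleftrightarrow> s \<in> {- tan (gap i / 2)..tan (gap (Suc i) / 2)}" for s
    unfolding tangent_point_in_P_iff atLeastAtMost_iff ..
  show ?thesis
  proof (intro subset_antisym subsetI)
    fix x assume x: "x \<in> side i"
    then obtain s where "x = ?f s" using param unfolding side_def by blast
    then show "x \<in> ?f ` {- tan (gap i / 2)..tan (gap (Suc i) / 2)}"
      using x inP[of s] unfolding side_def by blast
  next
    fix x assume "x \<in> ?f ` {- tan (gap i / 2)..tan (gap (Suc i) / 2)}"
    then obtain s where "x = ?f s" "s \<in> {- tan (gap i / 2)..tan (gap (Suc i) / 2)}" by blast
    then show "x \<in> side i" using inP[of s] line[of s] unfolding side_def by blast
  qed
qed

lemma tan_half_gap_pos: "0 < tan (gap i / 2)"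
  using half_gap[of i] by (intro tan_gt_zero) auto

lemma side_eq_segment: "side i = closed_segment (vertex i) (vertex (Suc i))"
proof -
  have le: "- tan (gap i / 2) \<le> tan (gap (Suc i) / 2)"
    using tan_half_gap_pos[of i] tan_half_gap_pos[of "Suc i"] by simp
  then show ?thesis
    unfolding side_eq_image affine_image_interval[OF le]
    by (simp only: vertex_eq(2)[of i] vertex_eq(1)[of "Suc i"])
qed

lemma diameter_side: "diameter (side i) = R * (tan (gap i / 2) + tan (gap (Suc i) / 2))"
proof -
  have "vertex (Suc i) - vertex i =
      (R * (tan (gap i / 2) + tan (gap (Suc i) / 2))) *\<^sub>R dir (\<theta> (Suc i) + pi/2)"
    unfolding vertex_eq(2)[of i] vertex_eq(1)[of "Suc i"]
    by (simp add: scaleR_add_left distrib_left mult.commute)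
  then have "dist (vertex (Suc i)) (vertex i) = R * (tan (gap i / 2) + tan (gap (Suc i) / 2))"
    using R_pos tan_half_gap_pos[of i] tan_half_gap_pos[of "Suc i"] by (simp add: dist_norm)
  then show ?thesis by (simp add: side_eq_segment diameter_closed_segment dist_commute)
qed

lemma contact_in_side: "c + R *\<^sub>R dir (\<theta> (Suc i)) \<in> side i"
  using R_pos tan_half_gap_pos[of i] tan_half_gap_pos[of "Suc i"]
  by (auto simp: side_eq_image intro!: image_eqI[of _ _ 0])

text \<open>The contact point of \<open>side i\<close> would also lie on the tangent carrying
  \<open>side j\<close>, which touches the circle only once.\<close>

lemma dir_eq_if_side_eq:
  assumes "side i = side j"
  shows "dir (\<theta> (Suc i)) = dir (\<theta> (Suc j))"
proof (rule unit_vectors_eq)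
  have "c + R *\<^sub>R dir (\<theta> (Suc i)) \<in> side j"
    using contact_in_side[of i] assms by simp
  then show "dir (\<theta> (Suc i)) \<bullet> dir (\<theta> (Suc j)) \<ge> 1"
    using R_pos by (simp add: side_def)
qed auto

lemma side_neq:
  assumes "i < j" "j < i + n"
  shows "side i \<noteq> side j"
  using dir_\<theta>_inj[of "Suc i" "Suc j"] dir_eq_if_side_eq[of i j] assms by auto

lemma side_inj: "inj_on side {..<n}"
proof (rule linorder_inj_onI)
  fix i j assume "i < j" "i \<in> {..<n}" "j \<in> {..<n}"
  then show "side i \<noteq> side j" by (intro side_neq) auto
qed auto

lemma edges_eq_sides: "{e. e edge_of P} = range side" "{e. e edge_of P} = side ` {..<n}"
proof -
  let ?f = "\<lambda>i. P \<inter> {x. (x - c) \<bullet> dir (\<theta> i) = R}"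
  \<comment> \<open>The window starts at 1 because \<open>side\<close> is indexed one step behind
    \<open>\<theta>\<close>.\<close>
  have 1: "?f ` {1..<1 + n} = range ?f"
    by (rule image_period_eq_range) (simp_all add: n_pos dir_period)
  have "range side \<subseteq> range ?f" by (auto simp: side_def)
  moreover have "range ?f \<subseteq> side ` {..<n}"
    unfolding 1[symmetric]
  proof (rule image_subsetI)
    fix k assume "k \<in> {1..<1 + n}"
    then have "?f k = side (k - 1)" "k - 1 \<in> {..<n}" by (auto simp: side_def)
    then show "?f k \<in> side ` {..<n}" by blast
  qed
  moreover have "side ` {..<n} \<subseteq> range side" by (rule image_mono) simp
  ultimately show "{e. e edge_of P} = range side" "{e. e edge_of P} = side ` {..<n}"
    unfolding edges_eq by (meson order.trans subset_antisym)+
qed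

lemma card_edges: "card {e. e edge_of P} = n"
  by (simp add: edges_eq_sides(2) card_image[OF side_inj])

lemma perimeter_eq: "perimeter P = 2 * R * (\<Sum>i<n. tan (gap i / 2))"
proof -
  have "perimeter P = (\<Sum>i<n. R * (tan (gap i / 2) + tan (gap (Suc i) / 2)))"
    unfolding perimeter_def edges_eq_sides(2) sum.reindex[OF side_inj] by (simp add: diameter_side)
  also have "\<dots> = R * ((\<Sum>i<n. tan (gap i / 2)) + (\<Sum>i<n. tan (gap (Suc i) / 2)))"
    by (simp add: sum.distrib flip: sum_distrib_left)
  also have "(\<Sum>i<n. tan (gap (Suc i) / 2)) = (\<Sum>i<n. tan (gap i / 2))"
    by (fact sum_Suc_gap[of "\<lambda>x. tan (x / 2)"])
  finally show ?thesis by (simp only: mult_2 distrib_left distrib_right)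
qed

end

section \<open>Area by triangulation from the centre\<close>

text \<open>For \<open>R > 0\<close> this is half of base times height: the base on the tangent has
  length \<open>R * \<bar>s - r\<bar>\<close>, and the height is \<open>R\<close>.\<close>

lemma area_triangle_tangent:
  "measure lebesgue (convex hull {c, c + R *\<^sub>R dir t + r *\<^sub>R (R *\<^sub>R dir (t + pi/2)),
      c + R *\<^sub>R dir t + s *\<^sub>R (R *\<^sub>R dir (t + pi/2))}) = R\<^sup>2 * \<bar>s - r\<bar> / 2" (is "measure lebesgue ?T = _")
proof -
  have "compact ?T" by (intro finite_imp_compact_convex_hull) auto
  then have "measure lebesgue ?T = measure lborel ?T"
    by (intro measure_completion) (simp add: borel_compact)
  also have "\<dots> = \<bar>(R * cos t - s * (R * sin t)) * (R * sin t + r * (R * cos t)) -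
      (R * cos t - r * (R * sin t)) * (R * sin t + s * (R * cos t))\<bar> / 2"
    by (simp add: content_triangle cos_add sin_add mult.assoc)
  also have "(R * cos t - s * (R * sin t)) * (R * sin t + r * (R * cos t)) -
      (R * cos t - r * (R * sin t)) * (R * sin t + s * (R * cos t)) = R\<^sup>2 * (r - s)"
    using sin_cos_squared_add[of t] by algebra
  finally show ?thesis by (simp add: abs_mult abs_minus_commute)
qed

context tangential_polygon
begin

lemma mem_P_iff: "x \<in> P \<longleftrightarrow> (\<forall>i. (x - c) \<bullet> dir (\<theta> i) \<le> R)"
  by (simp add: P_eq)

text \<open>The triangle over \<open>side i\<close> with apex \<open>c\<close>, as shown in
  \<open>sector_eq_hull\<close>. Describing it as the region where the normal of
  \<open>side i\<close> dominates makes the covering of \<open>P\<close> and the thin overlaps easy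
  to check.\<close>

definition sector :: "nat \<Rightarrow> (real^2) set" where
  "sector i = {x \<in> P. \<forall>j. (x - c) \<bullet> dir (\<theta> j) \<le> (x - c) \<bullet> dir (\<theta> (Suc i))}"

lemma convex_P: "convex P"
proof -
  have "P = (\<Inter>i. {x. dir (\<theta> i) \<bullet> x \<le> R + dir (\<theta> i) \<bullet> c})"
    by (auto simp: P_eq inner_diff inner_commute algebra_simps)
  then show ?thesis by (simp only: convex_INT convex_halfspace_le)
qed

lemma convex_sector: "convex (sector i)"
proof -
  have "sector i = P \<inter> (\<Inter>j. {x. (dir (\<theta> j) - dir (\<theta> (Suc i))) \<bullet> x \<le> (dir (\<theta> j) - dir (\<theta> (Suc i))) \<bullet> c})"
    by (auto simp: sector_def inner_diff inner_commute algebra_simps)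
  then show ?thesis by (simp only: convex_INT convex_halfspace_le convex_Int convex_P)
qed

text \<open>Central projection: a point of the sector other than \<open>c\<close> is pushed radially
  onto \<open>side i\<close>, and it lies on the segment from \<open>c\<close> to its image.\<close>

lemma sector_eq_hull: "sector i = convex hull {c, vertex i, vertex (Suc i)}"
proof
  have "c \<in> sector i" using R_pos by (simp add: sector_def mem_P_iff)
  moreover have "side i \<subseteq> sector i"
    by (auto simp: side_def sector_def mem_P_iff)
  then have "vertex i \<in> sector i" "vertex (Suc i) \<in> sector i"
    by (auto simp: side_eq_segment)
  ultimately show "convex hull {c, vertex i, vertex (Suc i)} \<subseteq> sector i"
    by (intro hull_minimal convex_sector) auto
next
  show "sector i \<subseteq> convex hull {c, vertex i, vertex (Suc i)}" (is "_ \<subseteq> ?H")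
  proof
    fix x assume x: "x \<in> sector i"
    \<comment> \<open>\<open>t\<close> is the height of \<open>x\<close> as a fraction of the
      distance from \<open>c\<close> to the tangent. Scaling by \<open>1 / t\<close> reaches the
      tangent without leaving \<open>P\<close>, since no other normal gives a larger value.\<close>
    define t where "t = (x - c) \<bullet> dir (\<theta> (Suc i)) / R"
    have le: "(x - c) \<bullet> dir (\<theta> j) \<le> t * R" for j
      using x R_pos by (simp add: sector_def t_def)
    have t1: "t \<le> 1" using x R_pos by (simp add: sector_def mem_P_iff t_def)
    have "c \<in> ?H" by (simp add: hull_inc)
    show "x \<in> ?H"
    proof (cases "t > 0")
      case True
      define y where "y = c + (1 / t) *\<^sub>R (x - c)"
      have "(y - c) \<bullet> dir (\<theta> j) \<le> R" for j
      proof -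
        have "(y - c) \<bullet> dir (\<theta> j) = (x - c) \<bullet> dir (\<theta> j) / t" by (simp add: y_def)
        then show ?thesis using le[of j] True by (simp add: divide_le_eq mult.commute)
      qed
      moreover have "(y - c) \<bullet> dir (\<theta> (Suc i)) = R"
      proof -
        have "(x - c) \<bullet> dir (\<theta> (Suc i)) = t * R" using R_pos by (simp add: t_def)
        then show ?thesis using True by (simp add: y_def)
      qed
      ultimately have "y \<in> side i" by (simp add: side_def mem_P_iff)
      then have "y \<in> convex hull {vertex i, vertex (Suc i)}"
        by (simp add: side_eq_segment segment_convex_hull)
      then have "y \<in> ?H" using hull_mono[of "{vertex i, vertex (Suc i)}" "{c, vertex i, vertex (Suc i)}" convex] by blast
      moreover have "x = (1 - t) *\<^sub>R c + t *\<^sub>R y"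
        using True by (simp add: y_def algebra_simps)
      ultimately show ?thesis
        using \<open>c \<in> ?H\<close> True t1 by (simp add: convexD[OF convex_convex_hull])
    next
      case False
      then have "(x - c) \<bullet> dir (\<theta> j) \<le> 0" for j
        using le[of j] R_pos by (meson mult_nonpos_nonneg order.trans less_imp_le not_less)
      \<comment> \<open>A nonzero \<open>x - c\<close> would be the direction of a ray inside
        \<open>P\<close>.\<close>
      then have "x - c = 0" using no_ray by blast
      then show ?thesis using \<open>c \<in> ?H\<close> by simp
    qed
  qed
qed

lemma P_eq_Union_sectors: "P = (\<Union>i<n. sector i)"
proof
  show "P \<subseteq> (\<Union>i<n. sector i)"
  proof
    fix x assume "x \<in> P"
    define f where "f i = (x - c) \<bullet> dir (\<theta> (Suc i))" for i
    have "Max (f ` {..<n}) \<in> f ` {..<n}" using n_pos by (intro Max_in) auto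
    then obtain i where i: "i < n" "f i = Max (f ` {..<n})" by auto
    have "(x - c) \<bullet> dir (\<theta> j) \<le> f i" for j
    proof -
      obtain k where k: "k \<in> {1..<1 + n}" "dir (\<theta> j) = dir (\<theta> k)"
        using dir_window by blast
      then have "k - 1 < n" "(x - c) \<bullet> dir (\<theta> j) = f (k - 1)" by (auto simp: f_def)
      then show ?thesis using i(2) by simp
    qed
    then have "x \<in> sector i" using \<open>x \<in> P\<close> by (simp add: sector_def f_def)
    then show "x \<in> (\<Union>i<n. sector i)" using i(1) by blast
  qed
qed (auto simp: sector_def)

text \<open>On the overlap both normals attain the maximum, hence give equal values, which confines
  it to a line through \<open>c\<close>.\<close>

lemma negligible_sector_Int:
  assumes "i < n" "j < n" "i \<noteq> j"
  shows "negligible (sector i \<inter> sector j)"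
proof (rule negligible_subset)
  let ?w = "dir (\<theta> (Suc i)) - dir (\<theta> (Suc j))"
  have "dir (\<theta> (Suc i)) \<noteq> dir (\<theta> (Suc j))"
  proof (cases "i < j")
    case True
    then show ?thesis using dir_\<theta>_inj[of "Suc i" "Suc j"] assms by auto
  next
    case False
    then show ?thesis using dir_\<theta>_inj[of "Suc j" "Suc i"] assms by auto
  qed
  then show "negligible {x. ?w \<bullet> x = ?w \<bullet> c}" by (intro negligible_hyperplane) simp
  show "sector i \<inter> sector j \<subseteq> {x. ?w \<bullet> x = ?w \<bullet> c}"
  proof
    fix x assume "x \<in> sector i \<inter> sector j"
    then have "(x - c) \<bullet> dir (\<theta> (Suc i)) = (x - c) \<bullet> dir (\<theta> (Suc j))"
      by (auto simp: sector_def intro: antisym)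
    then show "x \<in> {x. ?w \<bullet> x = ?w \<bullet> c}"
      by (simp add: inner_diff inner_commute algebra_simps)
  qed
qed

lemma area_sector: "area (sector i) = R\<^sup>2 * (tan (gap i / 2) + tan (gap (Suc i) / 2)) / 2"
  unfolding sector_eq_hull vertex_eq(2)[of i] vertex_eq(1)[of "Suc i"] area_triangle_tangent
  using tan_half_gap_pos[of i] tan_half_gap_pos[of "Suc i"] by simp

lemma area_eq: "area P = R\<^sup>2 * (\<Sum>i<n. tan (gap i / 2))"
proof -
  have "sector i \<in> lmeasurable" for i
    unfolding sector_eq_hull by (intro lmeasurable_compact finite_imp_compact_convex_hull) auto
  then have "area P = (\<Sum>i<n. area (sector i))"
    by (subst P_eq_Union_sectors, intro measure_negligible_finite_Union_image) (auto simp: pairwise_def negligible_sector_Int)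
  also have "\<dots> = R\<^sup>2 / 2 * ((\<Sum>i<n. tan (gap i / 2)) + (\<Sum>i<n. tan (gap (Suc i) / 2)))"
    by (simp add: area_sector sum.distrib flip: sum_distrib_left sum_divide_distrib)
  also have "(\<Sum>i<n. tan (gap (Suc i) / 2)) = (\<Sum>i<n. tan (gap i / 2))"
    by (fact sum_Suc_gap[of "\<lambda>x. tan (x / 2)"])
  finally show ?thesis by simp
qed

section \<open>Interior angles and regularity\<close>

lemma norm_vertex: "norm (vertex i - c) = R / cos (gap i / 2)"
  using R_pos cos_half_gap[of i] by (simp add: vertex_def)

text \<open>A segment determines its pair of end points. This serves \<open>regular_polygon\<close>,
  which quantifies over arbitrary points \<open>v\<close>, \<open>a\<close>,
  \<open>b\<close>.\<close>

lemma side_segment_end: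
  assumes "closed_segment v a = side i"
  shows "v \<in> range vertex"
  using assms unfolding side_eq_segment closed_segment_eq by (auto simp: doubleton_eq_iff)

text \<open>The contact point lies on the side and differs from \<open>v\<close>, because a vertex
  is farther than \<open>R\<close> from \<open>c\<close>. Leaving \<open>v\<close> towards
  \<open>a\<close> thus means heading for the contact point.\<close>

lemma other_end_direction:
  assumes seg: "closed_segment v a = side i" and v: "v = vertex m"
  obtains k where "k > 0" "a - v = k *\<^sub>R (R *\<^sub>R dir (\<theta> (Suc i)) - (v - c))"
proof -
  let ?p = "c + R *\<^sub>R dir (\<theta> (Suc i))"
  have "?p \<in> closed_segment v a" using contact_in_side seg by simp
  then obtain u where u: "0 \<le> u" "u \<le> 1" "?p = (1 - u) *\<^sub>R v + u *\<^sub>R a"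
    by (auto simp: in_segment)
  have "u \<noteq> 0"
  proof
    assume "u = 0"
    then have "v = ?p" using u(3) by simp
    then have "norm (v - c) = R" using R_pos by simp
    then show False using norm_vertex[of m] cos_half_gap[of m] R_pos v by (simp add: field_simps)
  qed
  moreover have "R *\<^sub>R dir (\<theta> (Suc i)) - (v - c) = u *\<^sub>R (a - v)"
  proof -
    have "R *\<^sub>R dir (\<theta> (Suc i)) - (v - c) = ?p - v" by simp
    also have "\<dots> = u *\<^sub>R (a - v)" unfolding u(3) by (simp add: algebra_simps)
    finally show ?thesis .
  qed
  ultimately have "1 / u > 0" "a - v = (1 / u) *\<^sub>R (R *\<^sub>R dir (\<theta> (Suc i)) - (v - c))"
    using u(1) by auto
  then show thesis by (rule that)
qed

text \<open>\<open>tangent_angle\<close> applies with \<open>w = v - c\<close>, whose norm is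
  \<open>R / cos (gap m / 2)\<close>; the cosine of the angle becomes
  \<open>1 - 2 * cos^2 (gap m / 2)\<close>, that is, \<open>- cos (gap m)\<close>.\<close>

lemma angle_at_vertex:
  assumes sides: "closed_segment v a = side i" "closed_segment v b = side j" and "a \<noteq> b"
    and v: "v = vertex m"
  shows "angle_at v a b = pi - gap m"
proof -
  have "side i \<noteq> side j"
    using \<open>a \<noteq> b\<close> unfolding sides[symmetric] by (auto simp: doubleton_eq_iff)
  then have neq: "dir (\<theta> (Suc i)) \<noteq> dir (\<theta> (Suc j))" by (auto simp: side_def)
  have "v \<in> side i" "v \<in> side j" unfolding sides[symmetric] by auto
  then have w: "(v - c) \<bullet> dir (\<theta> (Suc i)) = R" "(v - c) \<bullet> dir (\<theta> (Suc j)) = R"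
    by (auto simp: side_def)
  obtain k where k: "k > 0" "a - v = k *\<^sub>R (R *\<^sub>R dir (\<theta> (Suc i)) - (v - c))"
    using other_end_direction[OF sides(1) v] .
  obtain l where l: "l > 0" "b - v = l *\<^sub>R (R *\<^sub>R dir (\<theta> (Suc j)) - (v - c))"
    using other_end_direction[OF sides(2) v] .
  have "angle_at v a b = arccos (1 - 2 * R\<^sup>2 / ((v - c) \<bullet> (v - c)))"
    by (rule tangent_angle[OF w R_pos neq k(2,1) l(2,1)])
  also have "(v - c) \<bullet> (v - c) = (R / cos (gap m / 2))\<^sup>2"
    using norm_vertex[of m] v by (simp flip: power2_norm_eq_inner)
  also have "1 - 2 * R\<^sup>2 / (R / cos (gap m / 2))\<^sup>2 = - cos (2 * (gap m / 2))"
    unfolding cos_double_cos using R_pos cos_half_gap[of m] by (simp add: power_divide)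
  also have "\<dots> = cos (pi - gap m)" by simp
  also have "arccos \<dots> = pi - gap m"
    using gap_pos[of m] gap_less_pi[of m] by (intro arccos_cos) auto
  finally show ?thesis .
qed

lemma gap_const:
  assumes "\<forall>i<n. gap i = g"
  shows "gap j = g"
proof -
  have eq: "gap ` {0..<0 + n} = range gap"
    by (rule image_period_eq_range) (simp_all add: n_pos gap_period)
  have "gap j \<in> range gap" by (rule rangeI)
  then obtain i where "i \<in> {0..<0 + n}" "gap j = gap i"
    unfolding eq[symmetric] by blast
  then show ?thesis using assms by simp
qed

lemma edge_of_P_iff: "e edge_of P \<longleftrightarrow> (\<exists>i. e = side i)"
proof -
  have "e edge_of P \<longleftrightarrow> e \<in> range side"
    by (subst edges_eq_sides(1)[symmetric]) simp
  then show ?thesis by (simp add: image_iff)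
qed

text \<open>Equal angles \<open>pi - gap i\<close> mean equal gaps, whose value is fixed by their
  sum \<open>2 * pi\<close>. Conversely, equal gaps make side lengths and angles constant.\<close>

lemma regular_iff: "regular_polygon P \<longleftrightarrow> (\<forall>i<n. gap i = 2 * pi / real n)"
proof
  assume "regular_polygon P"
  then have "\<exists>\<phi>. \<forall>v a b. closed_segment v a edge_of P \<and> closed_segment v b edge_of P \<and> a \<noteq> b
      \<longrightarrow> angle_at v a b = \<phi>"
    unfolding regular_polygon_def by (rule conjunct2)
  then obtain \<phi> where \<phi>: "\<forall>v a b. closed_segment v a edge_of P \<and> closed_segment v b edge_of P \<and> a \<noteq> b
      \<longrightarrow> angle_at v a b = \<phi>" ..
  have edge: "side i edge_of P" for i by (auto simp: edge_of_P_iff)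
  have gap_Suc: "gap (Suc i) = pi - \<phi>" for i
  proof -
    have sides: "closed_segment (vertex (Suc i)) (vertex i) = side i"
      "closed_segment (vertex (Suc i)) (vertex (Suc (Suc i))) = side (Suc i)"
      by (simp_all add: side_eq_segment closed_segment_commute)
    have "side i \<noteq> side (Suc i)" using n_ge_3 by (intro side_neq) auto
    then have neq: "vertex i \<noteq> vertex (Suc (Suc i))" using sides by metis
    have "angle_at (vertex (Suc i)) (vertex i) (vertex (Suc (Suc i))) = \<phi>"
      using neq by (intro \<phi>[rule_format] conjI) (simp_all only: sides edge simp_thms)
    then show ?thesis using angle_at_vertex[OF sides neq refl] by simp
  qed
  have "(\<Sum>i<n. gap (Suc i)) = 2 * pi" using sum_Suc_gap[of "\<lambda>x. x"] sum_gap by simp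
  then have "pi - \<phi> = 2 * pi / real n" using n_pos by (simp add: gap_Suc field_simps)
  \<comment> \<open>Shifting by one period gives index 0 a predecessor too.\<close>
  moreover have "gap i = pi - \<phi>" for i
    using gap_Suc[of "i + n - 1"] n_pos gap_period[of i] by simp
  ultimately show "\<forall>i<n. gap i = 2 * pi / real n" by simp
next
  assume "\<forall>i<n. gap i = 2 * pi / real n"
  then have gap: "gap i = 2 * pi / real n" for i by (rule gap_const)
  have "diameter e = R * (2 * tan (pi / real n))" if "e edge_of P" for e
  proof -
    from that[unfolded edge_of_P_iff] obtain i where "e = side i" ..
    then show ?thesis by (simp add: diameter_side gap)
  qed
  moreover have "angle_at v a b = pi - 2 * pi / real n"
    if edges: "closed_segment v a edge_of P" "closed_segment v b edge_of P" and "a \<noteq> b" for v a b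
  proof -
    obtain i j where ij: "closed_segment v a = side i" "closed_segment v b = side j"
      using edges unfolding edge_of_P_iff by (elim exE)
    obtain m where "v = vertex m" using side_segment_end[OF ij(1)] by (rule rangeE)
    then show ?thesis using angle_at_vertex[OF ij \<open>a \<noteq> b\<close>] gap by simp
  qed
  ultimately show "regular_polygon P"
    unfolding regular_polygon_def
    by (intro conjI exI[of _ "R * (2 * tan (pi / real n))"] exI[of _ "pi - 2 * pi / real n"] allI impI) simp_all
qed

lemma sum_tan_half_gap:
  shows "real n * tan (pi / real n) \<le> (\<Sum>i<n. tan (gap i / 2))"
    and "(\<Sum>i<n. tan (gap i / 2)) = real n * tan (pi / real n) \<longleftrightarrow> regular_polygon P"
proof -
  \<comment> \<open>\<open>n \<ge> 3\<close> keeps the mean half gap inside the interval on which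
    the tangent is convex.\<close>
  have m: "0 < pi / real n" "pi / real n < pi / 2"
    using n_ge_3 by (auto simp: field_simps)
  have sum: "(\<Sum>i<n. gap i / 2) = real (card {..<n}) * (pi / real n)"
    using sum_gap n_pos by (simp flip: sum_divide_distrib)
  note jensen = sum_tan_ge[of "{..<n}" "\<lambda>i. gap i / 2", OF _ _ m sum]
  show "real n * tan (pi / real n) \<le> (\<Sum>i<n. tan (gap i / 2))"
    using jensen(1) half_gap by simp
  have "(\<Sum>i<n. tan (gap i / 2)) = real n * tan (pi / real n) \<longleftrightarrow> (\<forall>i\<in>{..<n}. gap i / 2 = pi / real n)"
    using jensen(2) half_gap by simp
  also have "\<dots> \<longleftrightarrow> regular_polygon P"
    unfolding regular_iff by (auto simp: field_simps)
  finally show "(\<Sum>i<n. tan (gap i / 2)) = real n * tan (pi / real n) \<longleftrightarrow> regular_polygon P" .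
qed

end

section \<open>Ordering the normals of a given polygon\<close>

text \<open>The angles are sorted within one turn and continued periodically. The period is first
  their number \<open>m\<close>; counting edges inside the locale then gives
  \<open>m = n\<close>.\<close>

lemma circumscribed_polygon_tangential:
  assumes "R > 0" "convex_polygon n P" "circumscribed_about P c R"
  obtains \<theta> where "tangential_polygon \<theta> n c R P"
proof -
  obtain T where T: "finite T" "T \<subseteq> {0..<2 * pi}"
    and P: "P = {x. \<forall>t\<in>T. (x - c) \<bullet> dir t \<le> R}"
    and edges: "{e. e edge_of P} = (\<lambda>t. P \<inter> {x. (x - c) \<bullet> dir t = R}) ` T"
    by (rule circumscribed_polygon_halfplanes[OF assms])
  have bounded: "bounded P" and card: "card {e. e edge_of P} = n"
    using assms(2) by (auto simp: convex_polygon_def polytope_imp_bounded)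
  have "T \<noteq> {}"
  proof
    assume "T = {}"
    then have "\<not> bounded P" unfolding P by (intro unbounded_ray[of "dir 0" 0]) auto
    then show False using bounded by simp
  qed
  define m xs \<theta> where "m = card T" and "xs = sorted_list_of_set T"
    and "\<theta> i = xs ! (i mod m) + 2 * pi * real (i div m)" for i
  have "m > 0" using T(1) \<open>T \<noteq> {}\<close> by (simp add: m_def card_gt_0_iff)
  have xs: "length xs = m" "set xs = T" "sorted_wrt (<) xs"
    using T(1) by (simp_all add: xs_def m_def)
  have xs_range: "0 \<le> xs ! i" "xs ! i < 2 * pi" if "i < m" for i
    using nth_mem[of i xs] that xs T(2) by auto
  have less_Suc: "\<theta> i < \<theta> (Suc i)" for i
  \<comment> \<open>At the end of the list the sequence passes to the first angle one turn later,
    which is larger because all angles lie in \<open>[0, 2 pi)\<close>.\<close>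
  proof (cases "Suc (i mod m) = m")
    case True
    then have "\<theta> (Suc i) = xs ! 0 + 2 * pi * (real (i div m) + 1)"
      by (simp add: \<theta>_def mod_Suc div_Suc)
    also have "\<dots> = xs ! 0 + 2 * pi + 2 * pi * real (i div m)"
      by (simp add: algebra_simps)
    finally show ?thesis
      using xs_range[of 0] xs_range[of "i mod m"] \<open>m > 0\<close> by (simp add: \<theta>_def)
  next
    case False
    then have "Suc (i mod m) < m" using \<open>m > 0\<close> by (simp add: Suc_lessI)
    then have "xs ! (i mod m) < xs ! Suc (i mod m)"
      using sorted_wrt_nth_less[OF xs(3)] xs(1) by simp
    then show ?thesis using False by (simp add: \<theta>_def mod_Suc div_Suc)
  qed
  have period: "\<theta> (i + m) = \<theta> i + 2 * pi" for i
    using \<open>m > 0\<close> by (simp add: \<theta>_def algebra_simps)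
  have range: "(\<lambda>i. dir (\<theta> i)) ` UNIV = dir ` T"
  proof -
    have "(\<lambda>i. dir (\<theta> i)) ` {0..<0 + m} = range (\<lambda>i. dir (\<theta> i))"
      by (rule image_period_eq_range) (simp_all add: \<open>m > 0\<close> period)
    moreover have "\<theta> ` {0..<0 + m} = T"
    proof -
      have "\<theta> ` {0..<0 + m} = (\<lambda>i. xs ! i) ` {0..<length xs}"
        using xs(1) by (intro image_cong) (auto simp: \<theta>_def)
      also have "\<dots> = T" using xs(2) by (auto simp: set_conv_nth)
      finally show ?thesis .
    qed
    ultimately show ?thesis by (simp flip: image_image)
  qed
  have "P = {x. \<forall>u\<in>dir ` T. (x - c) \<bullet> u \<le> R}" unfolding ball_simps by (rule P)
  then have P': "P = {x. \<forall>i. (x - c) \<bullet> dir (\<theta> i) \<le> R}"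
    unfolding range[symmetric] by simp
  have "{e. e edge_of P} = (\<lambda>u. P \<inter> {x. (x - c) \<bullet> u = R}) ` dir ` T"
    unfolding image_image by (rule edges)
  then have edges': "{e. e edge_of P} = range (\<lambda>i. P \<inter> {x. (x - c) \<bullet> dir (\<theta> i) = R})"
    unfolding range[symmetric] image_image .
  have tp: "tangential_polygon \<theta> m c R P"
    by unfold_locales (fact assms(1) \<open>m > 0\<close> less_Suc period P' edges' bounded)+
  have "m = n" using tangential_polygon.card_edges[OF tp] card by simp
  then show thesis using tp that by blast
qed

text \<open>One real \<open>x\<close> governs both quantities. Stated outside the locale, this
  applies to two polygons with different angle sequences.\<close>

lemma circumscribed_polygon_measures:
  assumes "R > 0" "convex_polygon n P" "circumscribed_about P c R"
  obtains x where "perimeter P = 2 * R * x" "area P = R\<^sup>2 * x"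
    "real n * tan (pi / real n) \<le> x" "x = real n * tan (pi / real n) \<longleftrightarrow> regular_polygon P"
proof -
  obtain \<theta> where "tangential_polygon \<theta> n c R P"
    by (rule circumscribed_polygon_tangential[OF assms])
  then interpret tangential_polygon \<theta> n c R P .
  show thesis
    by (rule that[OF perimeter_eq area_eq sum_tan_half_gap])
qed

section \<open>Deduction of the two inequalities\<close>

lemma le_tan: "x \<le> tan x" if "0 \<le> x" "x < pi/2" for x :: real
  using arctan_le_self[of "tan x"] arctan_tan[of x] tan_pos_pi2_le[of x] that by simp

theorem theorem6:
  fixes \<Gamma> \<Gamma>' :: "(real^2) set" and c :: "real^2" and R L A A' d :: real and n \<alpha> k :: nat
  assumes "R > 0"
    and "convex_polygon n \<Gamma>" and "circumscribed_about \<Gamma> c R"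
    and "convex_polygon n \<Gamma>'" and "regular_polygon \<Gamma>'" and "circumscribed_about \<Gamma>' c R"
    and "L = perimeter \<Gamma>" and "A = area \<Gamma>" and "A' = area \<Gamma>'"
    and "d = real n * tan (pi / real n)"
    and "\<alpha> \<ge> 1" and "k \<ge> 2"
  shows "(L ^ (2*\<alpha>) - 4 ^ \<alpha> * (d * A) ^ \<alpha>
            \<le> 4 ^ \<alpha> / R ^ (2*(k-1)*\<alpha>) * (A ^ (k*\<alpha>) - A' ^ (k*\<alpha>)))
       \<and> (L ^ (2*\<alpha>) - 4 ^ \<alpha> * (d * A) ^ \<alpha>
            = 4 ^ \<alpha> / R ^ (2*(k-1)*\<alpha>) * (A ^ (k*\<alpha>) - A' ^ (k*\<alpha>))
          \<longleftrightarrow> regular_polygon \<Gamma>)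
       \<and> ((A / R^2) ^ (2*\<alpha>) - d ^ \<alpha> * (L / (2*R)) ^ \<alpha>
            \<le> (A / R^2) ^ (k*\<alpha>) - (A' / R^2) ^ (k*\<alpha>))
       \<and> ((A / R^2) ^ (2*\<alpha>) - d ^ \<alpha> * (L / (2*R)) ^ \<alpha>
            = (A / R^2) ^ (k*\<alpha>) - (A' / R^2) ^ (k*\<alpha>)
          \<longleftrightarrow> regular_polygon \<Gamma>)"
proof -
  obtain \<theta> where tp: "tangential_polygon \<theta> n c R \<Gamma>"
    by (rule circumscribed_polygon_tangential[OF assms(1-3)])
  have n3: "n \<ge> 3" by (rule tangential_polygon.n_ge_3[OF tp])
  obtain x where x: "perimeter \<Gamma> = 2 * R * x" "area \<Gamma> = R\<^sup>2 * x" "d \<le> x" "x = d \<longleftrightarrow> regular_polygon \<Gamma>"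
    using circumscribed_polygon_measures[OF assms(1-3)] \<open>d = _\<close> by metis
  \<comment> \<open>Regularity of \<open>\<Gamma>'\<close> gives \<open>y = d\<close>, so
    \<open>A'\<close> does not depend on the choice of the regular polygon.\<close>
  obtain y where y: "area \<Gamma>' = R\<^sup>2 * y" "y = d \<longleftrightarrow> regular_polygon \<Gamma>'"
    using circumscribed_polygon_measures[OF assms(1,4,6)] \<open>d = _\<close> by metis
  have L: "L = 2 * R * x" and A: "A = R\<^sup>2 * x" and A': "A' = R\<^sup>2 * d"
    using x y assms by simp_all
  \<comment> \<open>This yields \<open>d \<ge> pi\<close>, and so the bound \<open>D \<ge> 1\<close>
    required by \<open>pow_diff_le\<close>.\<close>
  have "pi / real n \<le> tan (pi / real n)"
    using n3 by (intro le_tan) (auto simp: field_simps)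
  then have "real n * (pi / real n) \<le> d"
    unfolding \<open>d = _\<close> by (intro mult_left_mono) auto
  then have d1: "1 \<le> d" using n3 pi_gt3 by simp
  define X D where "X = x ^ \<alpha>" and "D = d ^ \<alpha>"
  have XD: "1 \<le> D" "D \<le> X"
    using d1 x(3) by (auto simp: X_def D_def intro: one_le_power power_mono)
  have eq_iff: "X = D \<longleftrightarrow> regular_polygon \<Gamma>"
    using d1 x(3,4) \<open>\<alpha> \<ge> 1\<close> power_eq_imp_eq_base[of x \<alpha> d] by (auto simp: X_def D_def)
  \<comment> \<open>The first inequality is \<open>q\<close> times
    \<open>X^2 - D * X \<le> X^k - D^k\<close>; the second is the same inequality without the
    factor.\<close>
  define q where "q = 4 ^ \<alpha> * (R\<^sup>2) ^ \<alpha>"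
  have "q > 0" using \<open>R > 0\<close> by (simp add: q_def)
  have pow: "x ^ (2 * \<alpha>) = X\<^sup>2" "x ^ (k * \<alpha>) = X ^ k" "d ^ (k * \<alpha>) = D ^ k"
    by (simp_all add: X_def D_def mult.commute flip: power_mult)
  have "L ^ (2 * \<alpha>) = q * X\<^sup>2"
    using pow(1) by (simp add: L q_def power_mult_distrib power_mult)
  moreover have "4 ^ \<alpha> * (d * A) ^ \<alpha> = q * (D * X)"
    by (simp add: A q_def X_def D_def power_mult_distrib)
  moreover have "4 ^ \<alpha> / R ^ (2*(k-1)*\<alpha>) * (A ^ (k*\<alpha>) - A' ^ (k*\<alpha>)) = q * (X ^ k - D ^ k)"
  proof -
    \<comment> \<open>Writing \<open>k\<close> as a successor resolves the truncated subtraction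
      \<open>k - 1\<close> in the exponent.\<close>
    obtain j where "k = Suc j" using \<open>k \<ge> 2\<close> by (cases k) auto
    then have "2 * (k * \<alpha>) = 2 * (k - 1) * \<alpha> + 2 * \<alpha>" by simp
    then have "R ^ (2 * (k * \<alpha>)) = R ^ (2*(k-1)*\<alpha>) * R ^ (2 * \<alpha>)"
      by (simp only: power_add)
    then have Rk: "(R\<^sup>2) ^ (k * \<alpha>) = R ^ (2*(k-1)*\<alpha>) * (R\<^sup>2) ^ \<alpha>"
      by (simp only: power_mult[of R 2])
    have "A ^ (k*\<alpha>) - A' ^ (k*\<alpha>) = (R\<^sup>2) ^ (k * \<alpha>) * (X ^ k - D ^ k)"
      unfolding A A' power_mult_distrib pow by (rule right_diff_distrib[symmetric])
    then show ?thesis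
      unfolding Rk q_def using \<open>R > 0\<close> by simp
  qed
  moreover have "A / R\<^sup>2 = x" "L / (2 * R) = x" "A' / R\<^sup>2 = d"
    using \<open>R > 0\<close> by (simp_all add: A A' L)
  moreover have "q * X\<^sup>2 - q * (D * X) = q * (X\<^sup>2 - D * X)" by (rule right_diff_distrib[symmetric])
  moreover have "d ^ \<alpha> * x ^ \<alpha> = D * X" by (simp only: X_def D_def)
  ultimately show ?thesis
    using pow_diff_le[OF XD \<open>k \<ge> 2\<close>] eq_iff \<open>q > 0\<close>
    by (simp only: pow mult_le_cancel_left_pos mult_cancel_left) simp
qed

end
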